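(* Let $\mathcal M$ be an $\mathfrak L$-structure. Then $\mathcal M$ is a model of $T_{DML}$ if and only if it is a distributive metrically modular complete metric lattice (with the order $x\le y\iff x+y=y$ and with $+$ as the join).
   Context: We use continuous first-order logic of metric structures; a theory's sentences are required to take the value $0$ in a model. The language $\mathfrak L$ has one sort (a complete metric space $(X,d)$ of diameter $1$), constants $0,1$, and a binary function symbol $+$ that is contractive when $X\times X$ carries the $\ell^1$-metric. Write $|x|=d(x,0)$ and $a\mathbin{\dot-}b=\max\{a-b,0\}$. $T_{ML}$ consists of: $d(0,1)=1$; $\sup_x d(x+0,x)+d(x+1,1)$; $\sup_x d(x+x,x)$; $\sup_{x,y}d(x+y,y+x)$; $\sup_{x,y,z}d((x+y)+z,x+(y+z))$; $\sup_{x,y,z}(d(x+z,y+z)\mathbin{\dot-}d(x,y))$; $\sup_{x,y,z}\bigl([d(x,y)+d(z,0)]\mathbin{\dot-}[d(x+y,0)+d(x+z,x)+d(y+z,y)]\bigr)$. Every model of $T_{ML}$ is a complete lattice under $x\le y\iff x+y=y$, with join $+$; the meet is written $xy$. Let $\sigma_{\mathrm{mod}}=\sup_{x,y}\inf_z\max\{(|x|+|y|)\mathbin{\dot-}(|x+y|+|z|),\ d(x+z,x),\ d(y+z,y)\}$ and $T_{MML}=T_{ML}\cup\{\sigma_{\mathrm{mod}}\}$. Let $\phi_m(x,y,z)$ be a definable predicate of $\mathfrak L$ (uniform limit of $\mathfrak L$-formulas over models of $T_{MML}$) with $\phi_m^{\mathcal M}(x,y,z)=d(xy,z)$ in all models $\mathcal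 M$ of $T_{MML}$ (such a predicate exists). Let $\sigma_{\mathrm{dist}}=\sup_{x,y,z}\inf_{t,w}\max\{\phi_m(x,y,t),\phi_m(x,z,w),\phi_m(x,y+z,t+w)\}$ and $T_{DML}=T_{MML}\cup\{\sigma_{\mathrm{dist}}\}$. A complete metric lattice is a tuple $(L,<,+,\cdot,0,1,d)$ where $(L,<)$ is a partially ordered set with minimal element $0$ and maximal element $1$; $+$ (join) and $\cdot$ (meet) are commutative, associative, idempotent; $x\le y$ iff $x+y=y$ iff $xy=x$; and $d$ is a complete metric on $L$ with $d(1,0)=1$, $d(x+z,y+z)\le d(x,y)$, $d(x,y)\le d(x+y,0)-d(xy,0)$ for all $x,y,z\in L$. It is metrically modular if $|x+y|+|xy|=|x|+|y|$ for all $x,y$. *)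

theory Defs
  imports "HOL-Analysis.Analysis" "HOL-Algebra.Lattice" "HOL-Library.More_List"
begin

section \<open>Structures for the language with constants 0, 1 and a binary function symbol\<close>

record 'a lstr =
  univ :: "'a set"
  ds :: "'a \<Rightarrow> 'a \<Rightarrow> real"
  zr :: 'a
  on :: 'a
  pl :: "'a \<Rightarrow> 'a \<Rightarrow> 'a"

text \<open>As usual in continuous logic, 1 is the bound on the diameter that is part of the language;
  that it is attained in a model of the theories below is the axiom \<open>d(0,1) = 1\<close>.\<close>

definition lstructure :: "'a lstr \<Rightarrow> bool" where
  "lstructure M \<longleftrightarrow>
     Metric_space (univ M) (ds M) \<and> Metric_space.mcomplete (univ M) (ds M) \<and>
     (\<forall>x\<in>univ M. \<forall>y\<in>univ M. ds M x y \<le> 1) \<and>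
     zr M \<in> univ M \<and> on M \<in> univ M \<and>
     (\<forall>x\<in>univ M. \<forall>y\<in>univ M. pl M x y \<in> univ M) \<and>
     (\<forall>x\<in>univ M. \<forall>y\<in>univ M. \<forall>x'\<in>univ M. \<forall>y'\<in>univ M.
        ds M (pl M x y) (pl M x' y') \<le> ds M x x' + ds M y y')"


section \<open>Continuous first-order logic\<close>

datatype trm = Var nat | Zero | One | Plus trm trm

text \<open>In \<open>Conn u fs\<close> the connective \<open>u\<close> of arity \<open>n = length fs\<close> is a real function on
  $\mathbb{R}^n$, the latter being the set of sequences that vanish from index \<open>n\<close> on.
  \<open>Def \<phi> ts\<close> is the predicate that is the limit of the sequence \<open>\<phi>\<close>, applied to the
  terms \<open>ts\<close>, which are substituted for the variables 0, 1, 2, ...  It does not occur in formulas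
  of the language proper (\<open>is_formula\<close>).\<close>

datatype fml =
    Dist trm trm
  | Conn "(nat \<Rightarrow> real) \<Rightarrow> real" "fml list"
  | QSup nat fml
  | QInf nat fml
  | Def "nat \<Rightarrow> fml" "trm list"

primrec tval :: "'a lstr \<Rightarrow> (nat \<Rightarrow> 'a) \<Rightarrow> trm \<Rightarrow> 'a" where
  "tval M v (Var i) = v i"
| "tval M v Zero = zr M"
| "tval M v One = on M"
| "tval M v (Plus s t) = pl M (tval M v s) (tval M v t)"

definition assign :: "'a lstr \<Rightarrow> 'a list \<Rightarrow> nat \<Rightarrow> 'a" where
  "assign M xs = nth_default (zr M) xs"

primrec eval :: "'a lstr \<Rightarrow> fml \<Rightarrow> (nat \<Rightarrow> 'a) \<Rightarrow> real" where
  "eval M (Dist s t) = (\<lambda>v. ds M (tval M v s) (tval M v t))"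
| "eval M (Conn u fs) = (\<lambda>v. u (nth_default 0 (map (\<lambda>e. e v) (map (eval M) fs))))"
| "eval M (QSup i f) = (\<lambda>v. SUP a\<in>univ M. eval M f (v(i := a)))"
| "eval M (QInf i f) = (\<lambda>v. INF a\<in>univ M. eval M f (v(i := a)))"
| "eval M (Def \<phi> ts) = (\<lambda>v. lim (\<lambda>n. (eval M \<circ> \<phi>) n (assign M (map (tval M v) ts))))"

primrec tvars :: "trm \<Rightarrow> nat set" where
  "tvars (Var i) = {i}"
| "tvars Zero = {}"
| "tvars One = {}"
| "tvars (Plus s t) = tvars s \<union> tvars t"

primrec fvars :: "fml \<Rightarrow> nat set" where
  "fvars (Dist s t) = tvars s \<union> tvars t"
| "fvars (Conn u fs) = \<Union>(set (map fvars fs))"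
| "fvars (QSup i f) = fvars f - {i}"
| "fvars (QInf i f) = fvars f - {i}"
| "fvars (Def \<phi> ts) = \<Union>(tvars ` set ts)"

primrec is_formula :: "fml \<Rightarrow> bool" where
  "is_formula (Dist s t) \<longleftrightarrow> True"
| "is_formula (Conn u fs) \<longleftrightarrow>
     continuous_on {w. \<forall>i\<ge>length fs. w i = 0} u \<and> (\<forall>b\<in>set (map is_formula fs). b)"
| "is_formula (QSup i f) \<longleftrightarrow> is_formula f"
| "is_formula (QInf i f) \<longleftrightarrow> is_formula f"
| "is_formula (Def \<phi> ts) \<longleftrightarrow> False"

definition models :: "'a lstr \<Rightarrow> fml set \<Rightarrow> bool" where
  "models M T \<longleftrightarrow> lstructure M \<and> (\<forall>\<sigma>\<in>T. \<forall>v. range v \<subseteq> univ M \<longrightarrow> eval M \<sigma> v = 0)"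

text \<open>A definable predicate in \<open>k\<close> variables over the models of \<open>T\<close> is given by a sequence of
  formulas that converges uniformly, with a rate not depending on the model.  The models are those
  whose carrier is a subset of the type given by the first argument.\<close>

definition definable_predicate :: "'a itself \<Rightarrow> fml set \<Rightarrow> nat \<Rightarrow> (nat \<Rightarrow> fml) \<Rightarrow> bool" where
  "definable_predicate _ T k \<phi> \<longleftrightarrow>
     (\<forall>n. is_formula (\<phi> n) \<and> fvars (\<phi> n) \<subseteq> {..<k}) \<and>
     (\<forall>\<epsilon>>0. \<exists>n0. \<forall>m\<ge>n0. \<forall>n\<ge>n0. \<forall>(M::'a lstr) v.
        models M T \<longrightarrow> range v \<subseteq> univ M \<longrightarrow> \<bar>eval M (\<phi> m) v - eval M (\<phi> n) v\<bar> < \<epsilon>)"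

definition dval :: "'a lstr \<Rightarrow> (nat \<Rightarrow> fml) \<Rightarrow> 'a list \<Rightarrow> real" where
  "dval M \<phi> xs = lim (\<lambda>n. eval M (\<phi> n) (assign M xs))"

definition FPlus :: "fml \<Rightarrow> fml \<Rightarrow> fml" where
  "FPlus f g = Conn (\<lambda>w. w 0 + w 1) [f, g]"

definition FMonus :: "fml \<Rightarrow> fml \<Rightarrow> fml" where
  "FMonus f g = Conn (\<lambda>w. max (w 0 - w 1) 0) [f, g]"

definition FMax3 :: "fml \<Rightarrow> fml \<Rightarrow> fml \<Rightarrow> fml" where
  "FMax3 f g h = Conn (\<lambda>w. max (w 0) (max (w 1) (w 2))) [f, g, h]"

text \<open>Condition \<open>d(0,1) = 1\<close>, written as a sentence that is to have the value 0.\<close>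

definition FEqOne :: "fml \<Rightarrow> fml" where
  "FEqOne f = Conn (\<lambda>w. \<bar>w 0 - 1\<bar>) [f]"

definition FNorm :: "trm \<Rightarrow> fml" where
  "FNorm t = Dist t Zero"


section \<open>The theories\<close>

definition T_ML :: "fml set" where
  "T_ML = (let x = Var 0; y = Var 1; z = Var 2 in
    {FEqOne (Dist Zero One),
     QSup 0 (FPlus (Dist (Plus x Zero) x) (Dist (Plus x One) One)),
     QSup 0 (Dist (Plus x x) x),
     QSup 0 (QSup 1 (Dist (Plus x y) (Plus y x))),
     QSup 0 (QSup 1 (QSup 2 (Dist (Plus (Plus x y) z) (Plus x (Plus y z))))),
     QSup 0 (QSup 1 (QSup 2 (FMonus (Dist (Plus x z) (Plus y z)) (Dist x y)))),
     QSup 0 (QSup 1 (QSup 2 (FMonus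
       (FPlus (Dist x y) (Dist z Zero))
       (FPlus (Dist (Plus x y) Zero)
         (FPlus (Dist (Plus x z) x) (Dist (Plus y z) y))))))})"

definition sigma_mod :: fml where
  "sigma_mod = (let x = Var 0; y = Var 1; z = Var 2 in
     QSup 0 (QSup 1 (QInf 2 (FMax3
       (FMonus (FPlus (FNorm x) (FNorm y)) (FPlus (FNorm (Plus x y)) (FNorm z)))
       (Dist (Plus x z) x)
       (Dist (Plus y z) y)))))"

definition T_MML :: "fml set" where
  "T_MML = T_ML \<union> {sigma_mod}"

definition sigma_dist :: "(nat \<Rightarrow> fml) \<Rightarrow> fml" where
  "sigma_dist \<phi> = (let x = Var 0; y = Var 1; z = Var 2; t = Var 3; w = Var 4 in
     QSup 0 (QSup 1 (QSup 2 (QInf 3 (QInf 4 (FMax3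
       (Def \<phi> [x, y, t])
       (Def \<phi> [x, z, w])
       (Def \<phi> [x, Plus y z, Plus t w])))))))"

definition T_DML :: "(nat \<Rightarrow> fml) \<Rightarrow> fml set" where
  "T_DML \<phi> = T_MML \<union> {sigma_dist \<phi>}"

lemma continuous_on_coord: "continuous_on A (\<lambda>w :: nat \<Rightarrow> real. w i)"
  by (rule continuous_on_subset[OF continuous_on_product_coordinates subset_UNIV])

lemma is_formula_T_MML:
  assumes "\<sigma> \<in> T_MML"
  shows "is_formula \<sigma>" "fvars \<sigma> = {}"
  using assms
  by (auto simp: T_MML_def T_ML_def sigma_mod_def Let_def FPlus_def FMonus_def FMax3_def
      FEqOne_def FNorm_def intro!: continuous_intros continuous_on_coord)


section \<open>Metric lattices\<close>

definition join_order :: "'a set \<Rightarrow> ('a \<Rightarrow> 'a \<Rightarrow> 'a) \<Rightarrow> 'a gorder" where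
  "join_order L jn = \<lparr>carrier = L, eq = (=), le = (\<lambda>x y. jn x y = y)\<rparr>"

definition meet_of :: "'a lstr \<Rightarrow> 'a \<Rightarrow> 'a \<Rightarrow> 'a" where
  "meet_of M x y = Lattice.meet (join_order (univ M) (pl M)) x y"

locale complete_metric_lattice = Metric_space L d
  for L :: "'a set" and leq :: "'a \<Rightarrow> 'a \<Rightarrow> bool"
    and jn :: "'a \<Rightarrow> 'a \<Rightarrow> 'a" and mt :: "'a \<Rightarrow> 'a \<Rightarrow> 'a"
    and bt :: 'a and tp :: 'a and d :: "'a \<Rightarrow> 'a \<Rightarrow> real" +
  assumes order: "partial_order \<lparr>carrier = L, eq = (=), le = leq\<rparr>"
    and bt: "bt \<in> L" "\<And>x. x \<in> L \<Longrightarrow> leq bt x"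
    and tp: "tp \<in> L" "\<And>x. x \<in> L \<Longrightarrow> leq x tp"
    and jn_closed: "\<And>x y. \<lbrakk>x \<in> L; y \<in> L\<rbrakk> \<Longrightarrow> jn x y \<in> L"
    and mt_closed: "\<And>x y. \<lbrakk>x \<in> L; y \<in> L\<rbrakk> \<Longrightarrow> mt x y \<in> L"
    and jn_commute: "\<And>x y. \<lbrakk>x \<in> L; y \<in> L\<rbrakk> \<Longrightarrow> jn x y = jn y x"
    and mt_commute: "\<And>x y. \<lbrakk>x \<in> L; y \<in> L\<rbrakk> \<Longrightarrow> mt x y = mt y x"
    and jn_assoc: "\<And>x y z. \<lbrakk>x \<in> L; y \<in> L; z \<in> L\<rbrakk> \<Longrightarrow> jn (jn x y) z = jn x (jn y z)"
    and mt_assoc: "\<And>x y z. \<lbrakk>x \<in> L; y \<in> L; z \<in> L\<rbrakk> \<Longrightarrow> mt (mt x y) z = mt x (mt y z)"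
    and jn_idem: "\<And>x. x \<in> L \<Longrightarrow> jn x x = x"
    and mt_idem: "\<And>x. x \<in> L \<Longrightarrow> mt x x = x"
    and le_iff_jn: "\<And>x y. \<lbrakk>x \<in> L; y \<in> L\<rbrakk> \<Longrightarrow> leq x y \<longleftrightarrow> jn x y = y"
    and le_iff_mt: "\<And>x y. \<lbrakk>x \<in> L; y \<in> L\<rbrakk> \<Longrightarrow> leq x y \<longleftrightarrow> mt x y = x"
    and complete: "mcomplete"
    and d_tp_bt: "d tp bt = 1"
    and d_jn: "\<And>x y z. \<lbrakk>x \<in> L; y \<in> L; z \<in> L\<rbrakk> \<Longrightarrow> d (jn x z) (jn y z) \<le> d x y"
    and d_le: "\<And>x y. \<lbrakk>x \<in> L; y \<in> L\<rbrakk> \<Longrightarrow> d x y \<le> d (jn x y) bt - d (mt x y) bt"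

definition metrically_modular ::
    "'a set \<Rightarrow> ('a \<Rightarrow> 'a \<Rightarrow> 'a) \<Rightarrow> ('a \<Rightarrow> 'a \<Rightarrow> 'a) \<Rightarrow> 'a \<Rightarrow> ('a \<Rightarrow> 'a \<Rightarrow> real) \<Rightarrow> bool" where
  "metrically_modular L jn mt bt d \<longleftrightarrow>
     (\<forall>x\<in>L. \<forall>y\<in>L. d (jn x y) bt + d (mt x y) bt = d x bt + d y bt)"

definition distributive_on :: "'a set \<Rightarrow> ('a \<Rightarrow> 'a \<Rightarrow> 'a) \<Rightarrow> ('a \<Rightarrow> 'a \<Rightarrow> 'a) \<Rightarrow> bool" where
  "distributive_on L jn mt \<longleftrightarrow>
     (\<forall>x\<in>L. \<forall>y\<in>L. \<forall>z\<in>L. mt x (jn y z) = jn (mt x y) (mt x z))"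

end

theory Submission
  imports Defs
begin

text \<open>Write \<open>|x|\<close> for \<open>d x 0\<close>.  Reading \<open>d(x + z, x)\<close> as the defect of \<open>z\<close>, which vanishes exactly
  when \<open>z \<le> x\<close>, makes the axioms of \<open>T_ML\<close> and \<open>sigma_mod\<close> statements about approximate lower
  bounds.  The difficulty is that \<open>sigma_mod\<close> provides, for \<open>x\<close> and \<open>y\<close>, only elements \<open>z\<close> of small
  defect with \<open>|z|\<close> almost \<open>|x| + |y| - |x + y|\<close>, whereas modularity concerns the exact meet, and
  the axioms of \<open>T_ML\<close> alone do not force an element of small defect to be near an exact lower
  bound.

  The way out (\<open>ex_meet_norm_ge_approx\<close>) is to construct the meet as a limit of approximate lower
  bounds.  Let \<open>c\<close> be the largest number such that, for all \<open>e > 0\<close>, some \<open>z\<close> has defect below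
  \<open>e\<close> with respect to \<open>x\<close> and \<open>y\<close> and norm above \<open>c - e\<close>.  The defect is subadditive, so the
  join of two such elements is again an approximate lower bound, of norm at most about \<open>c\<close>; and
  \<open>d(a, b) \<le> 2|a + b| - |a| - |b|\<close>, so elements of defect tending to 0 and norm tending to \<open>c\<close> form
  a Cauchy sequence.  Its limit \<open>m\<close> is an exact lower bound of norm \<open>c\<close>.  If \<open>u\<close> is another lower
  bound, then so is \<open>m + u\<close>, whose norm is at most \<open>c\<close> by the choice of \<open>c\<close>, and hence
  \<open>d(m, m + u) \<le> |m + u| - |m| \<le> 0\<close>.  So \<open>m\<close> is the meet, and \<open>sigma_mod\<close> gives
  \<open>|x| + |y| - |x + y| \<le> |xy|\<close>.  The reverse inequality holds in every metric lattice
  (\<open>submodular\<close>), because joins are contractive.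

  Conversely, in a modular lattice \<open>|xz| \<ge> |z| - d(x + z, x)\<close>, and likewise for \<open>y\<close>; applying
  modularity once more to \<open>xz\<close> and \<open>yz\<close>, whose join lies below \<open>z\<close> and whose meet lies below \<open>xy\<close>,
  bounds \<open>|xy|\<close> from below.  This turns \<open>d(x, y) \<le> |x + y| - |xy|\<close> into the last axiom of \<open>T_ML\<close>
  (\<open>modular_imp_d_approx_meet\<close>).

  Once the meet is known, \<open>sigma_dist\<close> says that \<open>x(y + z)\<close> is approximated by joins of
  approximations to \<open>xy\<close> and \<open>xz\<close>; as the join is continuous, this is the distributive law.\<close>

section \<open>Sentences and their pointwise meaning\<close>

definition valuation :: "'a lstr \<Rightarrow> (nat \<Rightarrow> 'a) \<Rightarrow> bool" where
  "valuation M v \<longleftrightarrow> range v \<subseteq> univ M"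

text \<open>The bound makes \<open>SUP\<close> and \<open>INF\<close> over the reals meaningful at the quantifiers; nonnegativity
  turns ``the value is 0'' into a statement about all elements of the structure.\<close>

definition bounded_nonneg :: "'a lstr \<Rightarrow> fml \<Rightarrow> bool" where
  "bounded_nonneg M f \<longleftrightarrow> (\<exists>B. \<forall>v. valuation M v \<longrightarrow> 0 \<le> eval M f v \<and> eval M f v \<le> B)"

lemma valuation_upd: "valuation M v \<Longrightarrow> a \<in> univ M \<Longrightarrow> valuation M (v(i := a))"
  by (auto simp: valuation_def)

lemma eval_FPlus: "eval M (FPlus f g) v = eval M f v + eval M g v"
  by (simp add: FPlus_def nth_default_def)

lemma eval_FMonus: "eval M (FMonus f g) v = max (eval M f v - eval M g v) 0"
  by (simp add: FMonus_def nth_default_def)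

lemma eval_FMax3: "eval M (FMax3 f g h) v = max (eval M f v) (max (eval M g v) (eval M h v))"
  by (simp add: FMax3_def nth_default_def)

lemma eval_FEqOne: "eval M (FEqOne f) v = \<bar>eval M f v - 1\<bar>"
  by (simp add: FEqOne_def nth_default_def)

lemmas eval_connectives = eval_FPlus eval_FMonus eval_FMax3 eval_FEqOne

lemma lstructure_nonempty: "lstructure M \<Longrightarrow> univ M \<noteq> {}"
  by (auto simp: lstructure_def)

lemma tval_closed:
  assumes "lstructure M" "valuation M v"
  shows "tval M v t \<in> univ M"
  using assms by (induction t) (auto simp: valuation_def lstructure_def)

lemma bounded_nonnegE:
  assumes "bounded_nonneg M f"
  obtains B where "\<And>v. valuation M v \<Longrightarrow> 0 \<le> eval M f v"
    "\<And>v. valuation M v \<Longrightarrow> eval M f v \<le> B"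
  using assms by (auto simp: bounded_nonneg_def)

lemma bounded_nonneg_Dist:
  assumes "lstructure M"
  shows "bounded_nonneg M (Dist s t)"
proof -
  have "Metric_space (univ M) (ds M)" "\<forall>x\<in>univ M. \<forall>y\<in>univ M. ds M x y \<le> 1"
    using assms by (auto simp: lstructure_def)
  then show ?thesis
    using tval_closed[OF assms]
    by (auto simp: bounded_nonneg_def Metric_space.nonneg intro!: exI[of _ 1])
qed

lemma bounded_nonneg_FPlus:
  assumes "bounded_nonneg M f" "bounded_nonneg M g"
  shows "bounded_nonneg M (FPlus f g)"
proof -
  obtain A B where "\<And>v. valuation M v \<Longrightarrow> 0 \<le> eval M f v \<and> eval M f v \<le> A"
    "\<And>v. valuation M v \<Longrightarrow> 0 \<le> eval M g v \<and> eval M g v \<le> B"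
    using assms unfolding bounded_nonneg_def by blast
  then show ?thesis
    unfolding bounded_nonneg_def eval_FPlus by (intro exI[of _ "A + B"]) (auto intro: add_mono)
qed

lemma bounded_nonneg_FMonus:
  assumes "bounded_nonneg M f" "bounded_nonneg M g"
  shows "bounded_nonneg M (FMonus f g)"
proof -
  obtain A B where *: "\<And>v. valuation M v \<Longrightarrow> 0 \<le> eval M f v \<and> eval M f v \<le> A"
    "\<And>v. valuation M v \<Longrightarrow> 0 \<le> eval M g v \<and> eval M g v \<le> B"
    using assms unfolding bounded_nonneg_def by blast
  show ?thesis
    unfolding bounded_nonneg_def eval_FMonus
  proof (intro exI[of _ A] allI impI)
    fix v :: "nat \<Rightarrow> _" assume "valuation M v"
    from *(1)[OF this] *(2)[OF this]
    show "0 \<le> max (eval M f v - eval M g v) 0 \<and> max (eval M f v - eval M g v) 0 \<le> A"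
      by auto
  qed
qed

lemma bounded_nonneg_FMax3:
  assumes "bounded_nonneg M f" "bounded_nonneg M g" "bounded_nonneg M h"
  shows "bounded_nonneg M (FMax3 f g h)"
proof -
  obtain A B C where *: "\<And>v. valuation M v \<Longrightarrow> 0 \<le> eval M f v \<and> eval M f v \<le> A"
    "\<And>v. valuation M v \<Longrightarrow> 0 \<le> eval M g v \<and> eval M g v \<le> B"
    "\<And>v. valuation M v \<Longrightarrow> 0 \<le> eval M h v \<and> eval M h v \<le> C"
    using assms unfolding bounded_nonneg_def by blast
  show ?thesis
    unfolding bounded_nonneg_def eval_FMax3
  proof (intro exI[of _ "max A (max B C)"] allI impI)
    fix v :: "nat \<Rightarrow> _" assume "valuation M v"
    from *(1)[OF this] *(2)[OF this] *(3)[OF this]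
    show "0 \<le> max (eval M f v) (max (eval M g v) (eval M h v)) \<and>
        max (eval M f v) (max (eval M g v) (eval M h v)) \<le> max A (max B C)"
      by (auto simp: max_def)
  qed
qed

lemma bounded_nonneg_QSup:
  assumes "lstructure M" "bounded_nonneg M f"
  shows "bounded_nonneg M (QSup i f)"
proof -
  obtain B where r: "\<And>v. valuation M v \<Longrightarrow> 0 \<le> eval M f v"
    "\<And>v. valuation M v \<Longrightarrow> eval M f v \<le> B"
    using bounded_nonnegE[OF assms(2)] by blast
  obtain a where a: "a \<in> univ M" using lstructure_nonempty[OF assms(1)] by blast
  show ?thesis
    unfolding bounded_nonneg_def
  proof (intro exI[of _ B] allI impI)
    fix v :: "nat \<Rightarrow> _" assume "valuation M v"
    note upd = valuation_upd[OF this]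
    have "0 \<le> (SUP a\<in>univ M. eval M f (v(i := a)))"
      by (rule cSUP_upper2[OF _ a]) (auto intro!: bdd_aboveI2 r upd a)
    moreover have "(SUP a\<in>univ M. eval M f (v(i := a))) \<le> B"
      using a by (intro cSUP_least r upd) auto
    ultimately show "0 \<le> eval M (QSup i f) v \<and> eval M (QSup i f) v \<le> B" by simp
  qed
qed

lemma bounded_nonneg_QInf:
  assumes "lstructure M" "bounded_nonneg M f"
  shows "bounded_nonneg M (QInf i f)"
proof -
  obtain B where r: "\<And>v. valuation M v \<Longrightarrow> 0 \<le> eval M f v"
    "\<And>v. valuation M v \<Longrightarrow> eval M f v \<le> B"
    using bounded_nonnegE[OF assms(2)] by blast
  obtain a where a: "a \<in> univ M" using lstructure_nonempty[OF assms(1)] by blast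
  show ?thesis
    unfolding bounded_nonneg_def
  proof (intro exI[of _ B] allI impI)
    fix v :: "nat \<Rightarrow> _" assume "valuation M v"
    note upd = valuation_upd[OF this]
    have "(INF a\<in>univ M. eval M f (v(i := a))) \<le> B"
      by (rule cINF_lower2[OF _ a]) (auto intro!: bdd_belowI2 r upd a)
    moreover have "0 \<le> (INF a\<in>univ M. eval M f (v(i := a)))"
      using a by (intro cINF_greatest r upd) auto
    ultimately show "0 \<le> eval M (QInf i f) v \<and> eval M (QInf i f) v \<le> B" by simp
  qed
qed

lemmas bounded_nonneg_intros =
  bounded_nonneg_Dist bounded_nonneg_FPlus bounded_nonneg_FMonus bounded_nonneg_FMax3
  bounded_nonneg_QSup bounded_nonneg_QInf

lemma eval_QSup_eq_0_iff:
  assumes "lstructure M" "bounded_nonneg M f" "valuation M v"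
  shows "eval M (QSup i f) v = 0 \<longleftrightarrow> (\<forall>a\<in>univ M. eval M f (v(i := a)) = 0)"
proof
  obtain B where r: "\<And>v. valuation M v \<Longrightarrow> 0 \<le> eval M f v"
    "\<And>v. valuation M v \<Longrightarrow> eval M f v \<le> B"
    using bounded_nonnegE[OF assms(2)] by blast
  note upd = valuation_upd[OF assms(3)]
  assume "eval M (QSup i f) v = 0"
  moreover have "eval M f (v(i := a)) \<le> (SUP a\<in>univ M. eval M f (v(i := a)))"
    if "a \<in> univ M" for a
    by (rule cSUP_upper[OF that]) (auto intro!: bdd_aboveI2 r upd)
  ultimately show "\<forall>a\<in>univ M. eval M f (v(i := a)) = 0"
    using r(1)[OF upd] by (auto intro!: antisym)
qed (use lstructure_nonempty[OF assms(1)] in simp)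

text \<open>An infimum need not be attained, so a vanishing \<open>QInf\<close> provides approximate witnesses only.
  This is why the axioms \<open>sigma_mod\<close> and \<open>sigma_dist\<close> have to be read with an error \<open>e\<close>.\<close>

lemma eval_QInf_less_iff:
  assumes "lstructure M" "bounded_nonneg M f" "valuation M v"
  shows "eval M (QInf i f) v < e \<longleftrightarrow> (\<exists>a\<in>univ M. eval M f (v(i := a)) < e)"
proof -
  have "bdd_below ((\<lambda>a. eval M f (v(i := a))) ` univ M)"
    using assms(2) valuation_upd[OF assms(3)]
    by (auto simp: bounded_nonneg_def intro!: bdd_belowI2[of _ 0])
  then show ?thesis
    using lstructure_nonempty[OF assms(1)] by (simp add: cINF_less_iff)
qed

lemma eval_QInf_eq_0_iff:
  assumes "lstructure M" "bounded_nonneg M f" "valuation M v"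
  shows "eval M (QInf i f) v = 0 \<longleftrightarrow> (\<forall>e>0. \<exists>a\<in>univ M. eval M f (v(i := a)) < e)"
proof -
  have "0 \<le> eval M (QInf i f) v"
    using bounded_nonneg_QInf[OF assms(1,2)] assms(3) by (auto simp: bounded_nonneg_def simp del: eval.simps)
  then have "eval M (QInf i f) v = 0 \<longleftrightarrow> (\<forall>e>0. eval M (QInf i f) v < e)"
    by (metis less_eq_real_def less_irrefl)
  then show ?thesis using eval_QInf_less_iff[OF assms] by simp
qed


section \<open>Approximate lower bounds and the existence of meets\<close>

text \<open>The models of \<open>T_ML\<close>, with the axioms holding at all points
  (see \<open>models_T_ML_iff\<close>).\<close>

locale T_ML_algebra = Metric_space L d
  for L :: "'a set" and d :: "'a \<Rightarrow> 'a \<Rightarrow> real" +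
  fixes jn :: "'a \<Rightarrow> 'a \<Rightarrow> 'a" (infixl "\<curlyvee>" 65) and bt tp :: 'a
  assumes mcomplete: "mcomplete"
    and bt_closed: "bt \<in> L" and tp_closed: "tp \<in> L"
    and jn_closed: "\<And>x y. x \<in> L \<Longrightarrow> y \<in> L \<Longrightarrow> x \<curlyvee> y \<in> L"
    and d_bt_tp: "d bt tp = 1"
    and jn_bt: "\<And>x. x \<in> L \<Longrightarrow> x \<curlyvee> bt = x"
    and jn_tp: "\<And>x. x \<in> L \<Longrightarrow> x \<curlyvee> tp = tp"
    and jn_idem: "\<And>x. x \<in> L \<Longrightarrow> x \<curlyvee> x = x"
    and jn_commute: "\<And>x y. x \<in> L \<Longrightarrow> y \<in> L \<Longrightarrow> x \<curlyvee> y = y \<curlyvee> x"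
    and jn_assoc: "\<And>x y z. x \<in> L \<Longrightarrow> y \<in> L \<Longrightarrow> z \<in> L \<Longrightarrow> x \<curlyvee> y \<curlyvee> z = x \<curlyvee> (y \<curlyvee> z)"
    and d_jn: "\<And>x y z. x \<in> L \<Longrightarrow> y \<in> L \<Longrightarrow> z \<in> L \<Longrightarrow> d (x \<curlyvee> z) (y \<curlyvee> z) \<le> d x y"
    and d_approx_meet: "\<And>x y z. x \<in> L \<Longrightarrow> y \<in> L \<Longrightarrow> z \<in> L \<Longrightarrow>
      d x y + d z bt \<le> d (x \<curlyvee> y) bt + (d (x \<curlyvee> z) x + d (y \<curlyvee> z) y)"
begin

lemma d_jn_left:
  assumes "x \<in> L" "y \<in> L" "z \<in> L"
  shows "d (z \<curlyvee> x) (z \<curlyvee> y) \<le> d x y"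
  using assms d_jn[of x y z] by (simp add: jn_commute)

lemma d_le_norm_diff:
  assumes "x \<in> L" "y \<in> L" "x \<curlyvee> y = y"
  shows "d x y \<le> d y bt - d x bt"
  using d_approx_meet[of x y x] assms by (simp add: jn_idem jn_commute)

lemma norm_mono:
  assumes "x \<in> L" "y \<in> L" "x \<curlyvee> y = y"
  shows "d x bt \<le> d y bt"
  using d_le_norm_diff[OF assms] nonneg[of x y] by linarith

lemma jn_upper:
  assumes "x \<in> L" "y \<in> L"
  shows "x \<curlyvee> (x \<curlyvee> y) = x \<curlyvee> y" "y \<curlyvee> (x \<curlyvee> y) = x \<curlyvee> y"
proof -
  show "x \<curlyvee> (x \<curlyvee> y) = x \<curlyvee> y"
    using assms by (simp add: jn_idem jn_assoc[symmetric])
  have "y \<curlyvee> (x \<curlyvee> y) = x \<curlyvee> (y \<curlyvee> y)"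
    using assms jn_closed by (metis jn_assoc jn_commute)
  then show "y \<curlyvee> (x \<curlyvee> y) = x \<curlyvee> y"
    using assms by (simp add: jn_idem)
qed

lemma norm_le_1: "x \<in> L \<Longrightarrow> d x bt \<le> 1"
  using norm_mono[of x tp] by (simp add: tp_closed jn_tp d_bt_tp commute)

text \<open>How far \<open>z\<close> is from lying below \<open>x\<close>: the defect is 0 iff \<open>z \<curlyvee> x = x\<close>.\<close>

abbreviation defect :: "'a \<Rightarrow> 'a \<Rightarrow> real" where
  "defect x z \<equiv> d (x \<curlyvee> z) x"

text \<open>Joins of approximate lower bounds are approximate lower bounds.\<close>

lemma defect_jn:
  assumes "x \<in> L" "a \<in> L" "b \<in> L"
  shows "defect x (a \<curlyvee> b) \<le> defect x a + defect x b"
proof -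
  have "d (x \<curlyvee> a \<curlyvee> b) x \<le> d (x \<curlyvee> a \<curlyvee> b) (x \<curlyvee> b) + d (x \<curlyvee> b) x"
    using assms by (intro triangle) (auto simp: jn_closed)
  also have "d (x \<curlyvee> a \<curlyvee> b) (x \<curlyvee> b) \<le> d (x \<curlyvee> a) x"
    using assms by (intro d_jn) (auto simp: jn_closed)
  finally show ?thesis using assms by (simp add: jn_assoc)
qed

lemma defect_lipschitz:
  assumes "x \<in> L" "a \<in> L" "b \<in> L"
  shows "defect x a \<le> defect x b + d a b"
  using triangle[of "x \<curlyvee> a" "x \<curlyvee> b" x] d_jn_left[of a b x] assms by (simp add: jn_closed)

text \<open>Two elements are close as soon as their join is not much larger than either of them: pass
  from \<open>a\<close> to \<open>b\<close> through \<open>a \<curlyvee> b\<close>.  This is what makes norm-maximising sequences converge.\<close>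

lemma d_le_norm_jn:
  assumes "a \<in> L" "b \<in> L"
  shows "d a b \<le> 2 * d (a \<curlyvee> b) bt - d a bt - d b bt"
  using triangle[of a "a \<curlyvee> b" b] d_le_norm_diff[of a "a \<curlyvee> b"] d_le_norm_diff[of b "a \<curlyvee> b"]
    jn_upper[of a b] commute[of b "a \<curlyvee> b"] assms by (simp add: jn_closed)

text \<open>The meet exists, and its norm is at least every value that can be approached by norms of
  approximate lower bounds, although an individual approximate lower bound may be far from any exact
  one.  Maximising over approximate rather than exact lower bounds yields both claims at once.\<close>

lemma ex_meet_norm_ge_approx:
  assumes x: "x \<in> L" and y: "y \<in> L"
  obtains m where "m \<in> L" "m \<curlyvee> x = x" "m \<curlyvee> y = y"
    "\<And>u. u \<in> L \<Longrightarrow> u \<curlyvee> x = x \<Longrightarrow> u \<curlyvee> y = y \<Longrightarrow> u \<curlyvee> m = m"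
    "\<And>c. (\<And>e. 0 < e \<Longrightarrow> \<exists>z\<in>L. defect x z < e \<and> defect y z < e \<and> c - e < d z bt) \<Longrightarrow> c \<le> d m bt"
proof -
  define C where "C = {c. \<forall>e>0. \<exists>z\<in>L. defect x z < e \<and> defect y z < e \<and> c - e < d z bt}"
  have C0: "0 \<in> C"
    using x y bt_closed by (auto simp: C_def jn_bt intro!: bexI[of _ bt])
  have C1: "c \<le> 1" if c: "c \<in> C" for c
  proof (rule field_le_epsilon)
    fix e :: real assume "0 < e"
    then obtain z where "z \<in> L" "c - e < d z bt" using c unfolding C_def by blast
    then show "c \<le> 1 + e" using norm_le_1[of z] by simp
  qed
  have bdd: "bdd_above C" by (rule bdd_aboveI[OF C1])
  define c where "c = Sup C"
  have cC: "c \<in> C"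
    unfolding C_def
  proof (intro CollectI allI impI)
    fix e :: real assume e: "0 < e"
    then have "c - e/2 < Sup C" by (simp add: c_def)
    then obtain c' where c': "c' \<in> C" "c - e/2 < c'"
      using less_cSup_iff[OF _ bdd] C0 by blast
    then obtain z where "z \<in> L" "defect x z < e/2" "defect y z < e/2" "c' - e/2 < d z bt"
      using e half_gt_zero[OF e] unfolding C_def by blast
    then show "\<exists>z\<in>L. defect x z < e \<and> defect y z < e \<and> c - e < d z bt"
      using c' e by (intro bexI[of _ z]) auto
  qed
  \<comment> \<open>As \<open>c + \<eta>\<close> is not in \<open>C\<close>, elements of sufficiently small defect have norm at most
    \<open>c + \<eta>\<close>.\<close>
  have upper: "\<exists>\<delta>>0. \<forall>z\<in>L. defect x z < \<delta> \<longrightarrow> defect y z < \<delta> \<longrightarrow> d z bt \<le> c + \<eta>"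
    if \<eta>: "0 < \<eta>" for \<eta>
  proof -
    have "c + \<eta> \<notin> C" using cSup_upper[OF _ bdd, of "c + \<eta>"] \<eta> by (auto simp: c_def)
    then obtain e where "e > 0"
      "\<And>z. z \<in> L \<Longrightarrow> defect x z < e \<Longrightarrow> defect y z < e \<Longrightarrow> d z bt \<le> c + \<eta> - e"
      unfolding C_def by force
    then show ?thesis by (intro exI[of _ e]) force
  qed
  have "\<exists>z. z \<in> L \<and> defect x z < inverse (Suc n) \<and> defect y z < inverse (Suc n) \<and>
      c - inverse (Suc n) < d z bt" for n
  proof -
    have "0 < inverse (real (Suc n))" by simp
    then show ?thesis using cC unfolding C_def by blast
  qed
  then obtain z where z: "\<And>n. z n \<in> L" "\<And>n. defect x (z n) < inverse (Suc n)"
    "\<And>n. defect y (z n) < inverse (Suc n)" "\<And>n. c - inverse (Suc n) < d (z n) bt"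
    by metis
  have small: "\<exists>N. \<forall>n\<ge>N. inverse (real (Suc n)) < e" if "0 < e" for e
    using LIMSEQ_inverse_real_of_nat that by (auto simp: LIMSEQ_def)
  have "MCauchy z"
    unfolding MCauchy_def
  proof (intro conjI allI impI)
    show "range z \<subseteq> L" using z by auto
    fix e :: real assume e: "0 < e"
    then obtain \<delta> where \<delta>: "\<delta> > 0"
      "\<And>u. u \<in> L \<Longrightarrow> defect x u < \<delta> \<Longrightarrow> defect y u < \<delta> \<Longrightarrow> d u bt \<le> c + e/4"
      using upper[of "e/4"] by auto
    then obtain N where N: "\<And>n. n \<ge> N \<Longrightarrow> inverse (real (Suc n)) < min (\<delta>/2) (e/4)"
      using small[of "min (\<delta>/2) (e/4)"] e by auto
    have "d (z n) (z n') < e" if n: "N \<le> n" and n': "N \<le> n'" for n n'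
    proof -
      have "defect x (z n \<curlyvee> z n') < \<delta>" "defect y (z n \<curlyvee> z n') < \<delta>"
        using defect_jn[of x "z n" "z n'"] defect_jn[of y "z n" "z n'"] z(1) x y
          z(2)[of n] z(2)[of n'] z(3)[of n] z(3)[of n'] N[OF n] N[OF n'] by auto
      then have "d (z n \<curlyvee> z n') bt \<le> c + e/4" using z(1) by (intro \<delta>) (auto simp: jn_closed)
      then show ?thesis
        using d_le_norm_jn[of "z n" "z n'"] z(1) z(4)[of n] z(4)[of n'] N[OF n] N[OF n']
        by auto
    qed
    then show "\<exists>N. \<forall>n n'. N \<le> n \<longrightarrow> N \<le> n' \<longrightarrow> d (z n) (z n') < e" by blast
  qed
  then obtain m where m: "limitin mtopology z m sequentially"
    using mcomplete by (auto simp: mcomplete_def)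
  have mL: "m \<in> L" using m by (simp add: limitin_mspace)
  have lim: "\<exists>n. d m (z n) < e \<and> inverse (real (Suc n)) < e" if "0 < e" for e
  proof -
    obtain N1 where "\<forall>n\<ge>N1. d (z n) m < e"
      using m \<open>0 < e\<close> unfolding limit_metric_sequentially by blast
    moreover obtain N2 where "\<forall>n\<ge>N2. inverse (real (Suc n)) < e"
      using small \<open>0 < e\<close> by blast
    ultimately show ?thesis
      by (intro exI[of _ "max N1 N2"]) (auto simp: commute)
  qed
  have above: "x' \<curlyvee> m = x'" if x': "x' \<in> L" and def: "\<And>n. defect x' (z n) < inverse (Suc n)" for x'
  proof -
    have "defect x' m \<le> 0"
    proof (rule field_le_epsilon)
      fix e :: real assume "0 < e"
      then obtain n where "d m (z n) < e/2" "inverse (real (Suc n)) < e/2"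
        using lim[of "e/2"] by auto
      then show "defect x' m \<le> 0 + e"
        using defect_lipschitz[of x' m "z n"] def[of n] x' mL z(1)[of n] by auto
    qed
    then show ?thesis
      using x' mL nonneg[of "x' \<curlyvee> m" x'] zero[of "x' \<curlyvee> m" x'] by (simp add: jn_closed)
  qed
  have mx: "x \<curlyvee> m = x" and my: "y \<curlyvee> m = y" using above x y z by auto
  have cm: "c \<le> d m bt"
  proof (rule field_le_epsilon)
    fix e :: real assume "0 < e"
    then obtain n where "d m (z n) < e/2" "inverse (real (Suc n)) < e/2"
      using lim[of "e/2"] by auto
    then show "c \<le> d m bt + e"
      using triangle[of "z n" m bt] z(1)[of n] z(4)[of n] mL bt_closed by (auto simp: commute)
  qed
  show thesis
  proof
    show "m \<in> L" by (fact mL)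
    show "m \<curlyvee> x = x" "m \<curlyvee> y = y" using mx my mL x y by (auto simp: jn_commute)
    show "u \<curlyvee> m = m" if u: "u \<in> L" "u \<curlyvee> x = x" "u \<curlyvee> y = y" for u
    proof -
      have "defect x (m \<curlyvee> u) = 0" "defect y (m \<curlyvee> u) = 0"
        using u mx my mL x y by (simp_all add: jn_assoc[symmetric] jn_commute)
      then have "d (m \<curlyvee> u) bt \<le> c + \<eta>" if "0 < \<eta>" for \<eta>
        using upper[OF that] u mL jn_closed by auto
      then have "d (m \<curlyvee> u) bt \<le> c" using field_le_epsilon by blast
      then have "d m (m \<curlyvee> u) \<le> 0"
        using d_le_norm_diff[of m "m \<curlyvee> u"] jn_upper[of m u] u mL cm by (simp add: jn_closed)
      then show ?thesis
        using u mL nonneg[of m "m \<curlyvee> u"] zero[of m "m \<curlyvee> u"] by (simp add: jn_closed jn_commute)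
    qed
    show "b \<le> d m bt"
      if "\<And>e. 0 < e \<Longrightarrow> \<exists>z\<in>L. defect x z < e \<and> defect y z < e \<and> b - e < d z bt" for b
    proof -
      have "b \<in> C" using that by (auto simp: C_def)
      then show ?thesis using cSup_upper[OF _ bdd] cm by (force simp: c_def)
    qed
  qed
qed

lemma complete_metric_latticeI:
  assumes mt: "\<And>x y. x \<in> L \<Longrightarrow> y \<in> L \<Longrightarrow>
      mt x y \<in> L \<and> mt x y \<curlyvee> x = x \<and> mt x y \<curlyvee> y = y \<and>
      (\<forall>u\<in>L. u \<curlyvee> x = x \<longrightarrow> u \<curlyvee> y = y \<longrightarrow> u \<curlyvee> mt x y = mt x y)"
  shows "complete_metric_lattice L (\<lambda>x y. x \<curlyvee> y = y) jn mt bt tp d"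
proof -
  have trans: "x \<curlyvee> z = z" if "x \<in> L" "y \<in> L" "z \<in> L" "x \<curlyvee> y = y" "y \<curlyvee> z = z" for x y z
    using that by (metis jn_assoc)
  have anti: "x = y" if "x \<in> L" "y \<in> L" "x \<curlyvee> y = y" "y \<curlyvee> x = x" for x y
    using that by (metis jn_commute)
  have glb: "u \<curlyvee> mt x y = mt x y" if "u \<in> L" "x \<in> L" "y \<in> L" "u \<curlyvee> x = x" "u \<curlyvee> y = y" for u x y
    using mt that by blast
  have cl: "mt x y \<in> L" and lb1: "mt x y \<curlyvee> x = x" and lb2: "mt x y \<curlyvee> y = y"
    if "x \<in> L" "y \<in> L" for x y using mt that by blast+
  show ?thesis
  proof (intro complete_metric_lattice.intro complete_metric_lattice_axioms.intro)
    show "Metric_space L d" by unfold_locales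
    show "partial_order \<lparr>carrier = L, eq = (=), le = \<lambda>x y. x \<curlyvee> y = y\<rparr>"
      by unfold_locales (auto simp: jn_idem dest: anti intro: trans)
    show "mt x y = mt y x" if "x \<in> L" "y \<in> L" for x y
      using that by (intro anti[of "mt x y"] glb[of "mt x y"] glb[of "mt y x"] cl lb1 lb2)
    show "mt (mt x y) z = mt x (mt y z)" if xyz: "x \<in> L" "y \<in> L" "z \<in> L" for x y z
    proof (rule anti)
      have "mt (mt x y) z \<curlyvee> x = x" "mt (mt x y) z \<curlyvee> y = y"
        using trans[of "mt (mt x y) z" "mt x y"] xyz cl lb1 lb2 by auto
      then show "mt (mt x y) z \<curlyvee> mt x (mt y z) = mt x (mt y z)"
        using xyz by (intro glb cl lb2)
      have "mt x (mt y z) \<curlyvee> y = y" "mt x (mt y z) \<curlyvee> z = z"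
        using trans[of "mt x (mt y z)" "mt y z"] xyz cl lb1 lb2 by auto
      then show "mt x (mt y z) \<curlyvee> mt (mt x y) z = mt (mt x y) z"
        using xyz by (intro glb cl lb1)
    qed (use xyz cl in auto)
    show "mt x x = x" if "x \<in> L" for x
      using that by (intro anti[of "mt x x"] glb[of x] cl lb1) (auto simp: jn_idem)
    show "(x \<curlyvee> y = y) = (mt x y = x)" if xy: "x \<in> L" "y \<in> L" for x y
    proof
      assume "x \<curlyvee> y = y"
      then show "mt x y = x" using xy by (intro anti[of "mt x y"] glb[of x] cl lb1) (auto simp: jn_idem)
    next
      assume "mt x y = x"
      then show "x \<curlyvee> y = y" using lb2[OF xy] by simp
    qed
    show "d tp bt = 1" by (simp add: d_bt_tp commute)
    show "d x y \<le> d (x \<curlyvee> y) bt - d (mt x y) bt" if xy: "x \<in> L" "y \<in> L" for x y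
      using d_approx_meet[of x y "mt x y"] lb1[OF xy] lb2[OF xy] cl[OF xy] xy
      by (simp add: jn_commute)
  qed (auto simp: bt_closed tp_closed jn_closed cl jn_idem d_jn jn_bt jn_tp jn_assoc mcomplete
      intro: jn_commute simp: jn_commute[of bt])
qed

text \<open>Exact modularity satisfies \<open>sigma_mod\<close>, with the meet as the witness.\<close>

lemma modular_imp_approx_modular:
  assumes "metrically_modular L jn mt bt d"
    and mt: "\<And>x y. x \<in> L \<Longrightarrow> y \<in> L \<Longrightarrow> mt x y \<in> L \<and> mt x y \<curlyvee> x = x \<and> mt x y \<curlyvee> y = y"
    and xy: "x \<in> L" "y \<in> L" and "0 < e"
  shows "\<exists>z\<in>L. d x bt + d y bt - (d (x \<curlyvee> y) bt + d z bt) < e \<and> defect x z < e \<and> defect y z < e"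
proof (intro bexI[of _ "mt x y"] conjI)
  show "d x bt + d y bt - (d (x \<curlyvee> y) bt + d (mt x y) bt) < e"
    using assms by (auto simp: metrically_modular_def)
  show "defect x (mt x y) < e" "defect y (mt x y) < e"
    using mt[OF xy] xy \<open>0 < e\<close> by (auto simp: jn_commute)
qed (use mt xy in auto)

end


section \<open>Norms in a metric lattice\<close>

context complete_metric_lattice
begin

lemma leqD:
  "leq x y \<Longrightarrow> x \<in> L \<Longrightarrow> y \<in> L \<Longrightarrow> jn x y = y"
  "leq x y \<Longrightarrow> x \<in> L \<Longrightarrow> y \<in> L \<Longrightarrow> mt x y = x"
  by (simp add: le_iff_jn) (simp add: le_iff_mt)

lemma leq_trans:
  assumes "leq x y" "leq y z" "x \<in> L" "y \<in> L" "z \<in> L"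
  shows "leq x z"
  using assms by (metis jn_assoc le_iff_jn)

lemma mt_lower:
  assumes "x \<in> L" "y \<in> L"
  shows "leq (mt x y) x" "leq (mt x y) y"
proof -
  show y: "leq (mt x y) y"
    using assms by (simp add: le_iff_mt mt_closed mt_assoc mt_idem)
  show "leq (mt x y) x"
    using assms by (metis le_iff_mt mt_assoc mt_closed mt_commute mt_idem)
qed

lemma mt_greatest:
  assumes "u \<in> L" "x \<in> L" "y \<in> L" "leq u x" "leq u y"
  shows "leq u (mt x y)"
  using assms by (metis le_iff_mt mt_assoc mt_closed)

lemma jn_least:
  assumes "u \<in> L" "x \<in> L" "y \<in> L" "leq x u" "leq y u"
  shows "leq (jn x y) u"
  using assms by (metis le_iff_jn jn_assoc jn_closed)

lemma d_le_norm_diff: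
  assumes "x \<in> L" "y \<in> L" "leq x y"
  shows "d x y \<le> d y bt - d x bt"
  using d_le[of x y] leqD[OF assms(3,1,2)] assms by simp

lemma norm_mono:
  assumes "x \<in> L" "y \<in> L" "leq x y"
  shows "d x bt \<le> d y bt"
  using d_le_norm_diff[OF assms] nonneg[of x y] by linarith

text \<open>Joining the pair \<open>y\<close>, \<open>mt x y\<close> with \<open>x\<close> contracts it to the pair \<open>jn x y\<close>, \<open>x\<close>.\<close>

lemma submodular:
  assumes "x \<in> L" "y \<in> L"
  shows "d (jn x y) bt + d (mt x y) bt \<le> d x bt + d y bt"
proof -
  have "d (jn x y) x = d (jn y x) (jn (mt x y) x)"
    using assms leqD(1)[OF mt_lower(1)] by (simp add: jn_commute mt_closed)
  also have "\<dots> \<le> d (mt x y) y"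
    using assms d_jn[of y "mt x y" x] by (simp add: mt_closed commute)
  also have "\<dots> \<le> d y bt - d (mt x y) bt"
    using assms by (intro d_le_norm_diff mt_lower mt_closed)
  finally show ?thesis
    using triangle[of "jn x y" x bt] assms bt by (simp add: jn_closed)
qed

text \<open>By \<open>d_le\<close> it suffices that \<open>z\<close>, up to its defects, is not larger than \<open>mt x y\<close>.  Modularity
  shows that \<open>mt x z\<close> and \<open>mt y z\<close> are almost as large as \<open>z\<close>; both lie below \<open>z\<close>, so, by
  modularity again, their meet is almost as large, too, and it lies below \<open>mt x y\<close>.\<close>

lemma modular_imp_d_approx_meet:
  assumes mod: "metrically_modular L jn mt bt d" and xyz: "x \<in> L" "y \<in> L" "z \<in> L"
  shows "d x y + d z bt \<le> d (jn x y) bt + (d (jn x z) x + d (jn y z) y)"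
proof -
  have eq: "d (jn a b) bt + d (mt a b) bt = d a bt + d b bt" if "a \<in> L" "b \<in> L" for a b
    using mod that by (simp add: metrically_modular_def)
  have ge: "d z bt - d (jn a z) a \<le> d (mt a z) bt" if "a \<in> L" for a
    using triangle[of "jn a z" a bt] eq[of a z] that xyz bt by (simp add: jn_closed)
  define a b where "a = mt x z" and "b = mt y z"
  have ab: "a \<in> L" "b \<in> L" using xyz by (simp_all add: a_def b_def mt_closed)
  have az: "leq a z" "leq b z" and abxy: "leq a x" "leq b y"
    using xyz by (simp_all add: a_def b_def mt_lower)
  have j: "d (jn a b) bt \<le> d z bt"
    using ab xyz az by (intro norm_mono jn_least jn_closed)
  have "leq (mt a b) (mt x y)"
    using ab xyz abxy mt_lower[of a b]
    by (intro mt_greatest mt_closed) (auto intro: leq_trans[of _ a] leq_trans[of _ b] mt_closed)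
  then have m: "d (mt a b) bt \<le> d (mt x y) bt"
    using ab xyz by (intro norm_mono mt_closed)
  have "d z bt - d (jn x z) x - d (jn y z) y \<le> d (mt x y) bt"
    using ge[OF xyz(1)] ge[OF xyz(2)] eq[OF ab] j m by (simp add: a_def b_def)
  then show ?thesis using d_le[OF xyz(1,2)] by simp
qed

end


section \<open>The theories in pointwise form\<close>

lemma models_T_ML_iff:
  fixes M :: "'a lstr"
  assumes M: "lstructure M"
  shows "models M T_ML \<longleftrightarrow> T_ML_algebra (univ M) (ds M) (pl M) (zr M) (on M)" (is "_ \<longleftrightarrow> ?A")
proof -
  interpret Metric_space "univ M" "ds M" using M by (simp add: lstructure_def)
  have cl: "zr M \<in> univ M" "on M \<in> univ M"
    "\<And>x y. x \<in> univ M \<Longrightarrow> y \<in> univ M \<Longrightarrow> pl M x y \<in> univ M"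
    using M by (auto simp: lstructure_def)
  have sum0: "ds M a b + ds M a' b' = 0 \<longleftrightarrow> ds M a b = 0 \<and> ds M a' b' = 0" for a b a' b'
    using nonneg[of a b] nonneg[of a' b'] by linarith
  have max0: "max (r - s) 0 = 0 \<longleftrightarrow> r \<le> s" for r s :: real by auto
  define P where "P \<longleftrightarrow> ds M (zr M) (on M) = 1 \<and>
    (\<forall>x\<in>univ M. pl M x (zr M) = x \<and> pl M x (on M) = on M) \<and>
    (\<forall>x\<in>univ M. pl M x x = x) \<and>
    (\<forall>x\<in>univ M. \<forall>y\<in>univ M. pl M x y = pl M y x) \<and>
    (\<forall>x\<in>univ M. \<forall>y\<in>univ M. \<forall>z\<in>univ M. pl M (pl M x y) z = pl M x (pl M y z)) \<and>
    (\<forall>x\<in>univ M. \<forall>y\<in>univ M. \<forall>z\<in>univ M. ds M (pl M x z) (pl M y z) \<le> ds M x y) \<and>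
    (\<forall>x\<in>univ M. \<forall>y\<in>univ M. \<forall>z\<in>univ M. ds M x y + ds M z (zr M) \<le>
        ds M (pl M x y) (zr M) + (ds M (pl M x z) x + ds M (pl M y z) y))"
  have "(\<forall>\<sigma>\<in>T_ML. eval M \<sigma> v = 0) \<longleftrightarrow> P" if v: "valuation M v" for v
    unfolding T_ML_def Let_def P_def
    by (simp add: eval_QSup_eq_0_iff bounded_nonneg_intros M v valuation_upd eval_connectives cl sum0 max0
        del: eval.simps(3))
  moreover have "valuation M (\<lambda>_. zr M)" using cl by (auto simp: valuation_def)
  ultimately have "models M T_ML \<longleftrightarrow> P" using M unfolding models_def valuation_def by blast
  also have "P \<longleftrightarrow> ?A"
  proof
    assume P
    then have ax: "ds M (zr M) (on M) = 1"
      "\<And>x. x \<in> univ M \<Longrightarrow> pl M x (zr M) = x" "\<And>x. x \<in> univ M \<Longrightarrow> pl M x (on M) = on M"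
      "\<And>x. x \<in> univ M \<Longrightarrow> pl M x x = x"
      "\<And>x y. x \<in> univ M \<Longrightarrow> y \<in> univ M \<Longrightarrow> pl M x y = pl M y x"
      "\<And>x y z. x \<in> univ M \<Longrightarrow> y \<in> univ M \<Longrightarrow> z \<in> univ M \<Longrightarrow>
        pl M (pl M x y) z = pl M x (pl M y z)"
      "\<And>x y z. x \<in> univ M \<Longrightarrow> y \<in> univ M \<Longrightarrow> z \<in> univ M \<Longrightarrow>
        ds M (pl M x z) (pl M y z) \<le> ds M x y"
      "\<And>x y z. x \<in> univ M \<Longrightarrow> y \<in> univ M \<Longrightarrow> z \<in> univ M \<Longrightarrow>
        ds M x y + ds M z (zr M) \<le>
          ds M (pl M x y) (zr M) + (ds M (pl M x z) x + ds M (pl M y z) y)"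
      unfolding P_def by blast+
    have complete: "mcomplete" using M by (simp add: lstructure_def)
    show ?A
      by (intro T_ML_algebra.intro T_ML_algebra_axioms.intro)
        (fact Metric_space_axioms complete ax cl)+
  next
    assume ?A
    then interpret A: T_ML_algebra "univ M" "ds M" "pl M" "zr M" "on M" .
    show P
      unfolding P_def
      by (intro conjI ballI A.d_bt_tp A.jn_bt A.jn_tp A.jn_idem A.jn_commute A.jn_assoc A.d_jn
          A.d_approx_meet)
  qed
  finally show ?thesis .
qed

lemma eval_sigma_mod_eq_0_iff:
  assumes M: "lstructure M" and v: "valuation M v"
  shows "eval M sigma_mod v = 0 \<longleftrightarrow> (\<forall>x\<in>univ M. \<forall>y\<in>univ M. \<forall>e>0. \<exists>z\<in>univ M.
    ds M x (zr M) + ds M y (zr M) - (ds M (pl M x y) (zr M) + ds M z (zr M)) < e \<and>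
    ds M (pl M x z) x < e \<and> ds M (pl M y z) y < e)"
  unfolding sigma_mod_def FNorm_def Let_def
  by (simp add: eval_QSup_eq_0_iff eval_QInf_eq_0_iff bounded_nonneg_intros M v valuation_upd eval_connectives
      del: eval.simps(3,4))

text \<open>The function \<open>mt\<close> stands for the meet.  Its closure makes the definable predicate take values
  between 0 and 1 on the structure, so that the quantifiers in front of it can be read pointwise.\<close>

lemma eval_sigma_dist_eq_0_iff:
  assumes M: "lstructure M" and v: "valuation M v"
    and mt: "\<And>x y. x \<in> univ M \<Longrightarrow> y \<in> univ M \<Longrightarrow> mt x y \<in> univ M"
    and \<phi>: "\<And>x y z. x \<in> univ M \<Longrightarrow> y \<in> univ M \<Longrightarrow> z \<in> univ M \<Longrightarrow>
      dval M \<phi> [x, y, z] = ds M (mt x y) z"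
  shows "eval M (sigma_dist \<phi>) v = 0 \<longleftrightarrow>
    (\<forall>x\<in>univ M. \<forall>y\<in>univ M. \<forall>z\<in>univ M. \<forall>e>0. \<exists>t\<in>univ M. \<exists>w\<in>univ M.
      ds M (mt x y) t < e \<and> ds M (mt x z) w < e \<and> ds M (mt x (pl M y z)) (pl M t w) < e)"
proof -
  have ev: "eval M (Def \<phi> [r, s, t]) u = ds M (mt (tval M u r) (tval M u s)) (tval M u t)"
    if "valuation M u" for u r s t
  proof -
    have "eval M (Def \<phi> [r, s, t]) u = dval M \<phi> [tval M u r, tval M u s, tval M u t]"
      by (simp add: dval_def)
    also have "\<dots> = ds M (mt (tval M u r) (tval M u s)) (tval M u t)"
      using that by (intro \<phi> tval_closed M)
    finally show ?thesis .
  qed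
  have "Metric_space (univ M) (ds M)" and le1: "\<forall>x\<in>univ M. \<forall>y\<in>univ M. ds M x y \<le> 1"
    using M by (simp_all add: lstructure_def)
  then interpret Metric_space "univ M" "ds M" by simp
  have rg: "bounded_nonneg M (Def \<phi> [r, s, t])" for r s t
    unfolding bounded_nonneg_def
  proof (intro exI[of _ 1] allI impI)
    fix u assume u: "valuation M u"
    show "0 \<le> eval M (Def \<phi> [r, s, t]) u \<and> eval M (Def \<phi> [r, s, t]) u \<le> 1"
      unfolding ev[OF u] by (intro conjI nonneg le1[rule_format] mt tval_closed M u)
  qed
  show ?thesis
    unfolding sigma_dist_def Let_def
    by (simp add: eval_QSup_eq_0_iff eval_QInf_eq_0_iff eval_QInf_less_iff bounded_nonneg_intros rg M v
        valuation_upd eval_connectives ev del: eval.simps(3,4,5))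
qed

lemma models_T_MML_iff:
  assumes "lstructure M"
  shows "models M T_MML \<longleftrightarrow>
    models M T_ML \<and> (\<forall>v. valuation M v \<longrightarrow> eval M sigma_mod v = 0)"
  using assms by (auto simp: models_def T_MML_def valuation_def)

lemma models_T_DML_iff:
  assumes "lstructure M"
  shows "models M (T_DML \<phi>) \<longleftrightarrow>
    models M T_MML \<and> (\<forall>v. valuation M v \<longrightarrow> eval M (sigma_dist \<phi>) v = 0)"
  using assms by (auto simp: models_def T_DML_def valuation_def)


section \<open>Modularity and distributivity of the models\<close>

lemma meet_of_eqI:
  assumes cl: "x \<in> univ M" "y \<in> univ M" "m \<in> univ M" and lb: "pl M m x = x" "pl M m y = y"
    and glb: "\<And>u. u \<in> univ M \<Longrightarrow> pl M u x = x \<Longrightarrow> pl M u y = y \<Longrightarrow> pl M u m = m"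
    and comm: "\<And>u. u \<in> univ M \<Longrightarrow> pl M u m = pl M m u"
  shows "meet_of M x y = m"
  unfolding meet_of_def meet_def inf_def
proof (rule some_equality)
  let ?L = "join_order (univ M) (pl M)"
  show "greatest ?L m (Lower ?L {x, y})"
    using cl lb glb by (auto simp: greatest_def Lower_def join_order_def)
  fix m' assume m': "greatest ?L m' (Lower ?L {x, y})"
  then have "m' \<in> univ M" "pl M m' x = x" "pl M m' y = y" "pl M m m' = m'"
    using cl lb by (auto simp: greatest_def Lower_def join_order_def)
  then show "m' = m" using glb comm by metis
qed

text \<open>The form in which \<open>sigma_dist\<close> is used: \<open>a\<close>, \<open>b\<close>, \<open>c\<close> will be the meets \<open>xy\<close>, \<open>xz\<close> and
  \<open>x(y + z)\<close>.\<close>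

lemma eq_jn_if_approx:
  assumes M: "lstructure M" and L: "a \<in> univ M" "b \<in> univ M" "c \<in> univ M"
    and approx: "\<And>e. 0 < e \<Longrightarrow>
      \<exists>t\<in>univ M. \<exists>w\<in>univ M. ds M a t < e \<and> ds M b w < e \<and> ds M c (pl M t w) < e"
  shows "c = pl M a b"
proof -
  interpret Metric_space "univ M" "ds M" using M by (simp add: lstructure_def)
  have jn: "pl M x y \<in> univ M" if "x \<in> univ M" "y \<in> univ M" for x y
    using M that by (simp add: lstructure_def)
  have contr: "ds M (pl M x y) (pl M x' y') \<le> ds M x x' + ds M y y'"
    if "x \<in> univ M" "y \<in> univ M" "x' \<in> univ M" "y' \<in> univ M" for x y x' y'
    using M that by (simp add: lstructure_def)
  have "ds M c (pl M a b) \<le> 0"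
  proof (rule field_le_epsilon)
    fix e :: real assume "0 < e"
    then obtain t w where tw: "t \<in> univ M" "w \<in> univ M"
      "ds M a t < e/3" "ds M b w < e/3" "ds M c (pl M t w) < e/3"
      using approx[of "e/3"] by auto
    then show "ds M c (pl M a b) \<le> 0 + e"
      using triangle[of c "pl M t w" "pl M a b"] contr[of t w a b] L
      by (simp add: jn commute)
  qed
  then show ?thesis using L nonneg[of c "pl M a b"] zero[of c "pl M a b"] jn by auto
qed

text \<open>Here the witnesses of \<open>sigma_mod\<close> are passed to \<open>ex_meet_norm_ge_approx\<close> with
  \<open>c = |x| + |y| - |x + y|\<close>.\<close>

lemma T_MML_model_meet:
  fixes M :: "'a lstr"
  assumes "models M T_MML"
  shows "complete_metric_lattice (univ M) (\<lambda>x y. pl M x y = y) (pl M) (meet_of M) (zr M) (on M) (ds M)"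
    and "metrically_modular (univ M) (pl M) (meet_of M) (zr M) (ds M)"
proof -
  have M: "lstructure M" using assms by (simp add: models_def)
  interpret T_ML_algebra "univ M" "ds M" "pl M" "zr M" "on M"
    using assms models_T_MML_iff[OF M] models_T_ML_iff[OF M] by blast
  have v: "valuation M (\<lambda>_. zr M)" using bt_closed by (auto simp: valuation_def)
  then have "eval M sigma_mod (\<lambda>_. zr M) = 0" using assms models_T_MML_iff[OF M] by blast
  note mod0 = this[unfolded eval_sigma_mod_eq_0_iff[OF M v], rule_format]
  have mod: "\<exists>z\<in>univ M. ds M x (zr M) + ds M y (zr M) - (ds M (pl M x y) (zr M) + ds M z (zr M)) < e \<and>
      defect x z < e \<and> defect y z < e"
    if "x \<in> univ M" "y \<in> univ M" "0 < e" for x y e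
    using that by (rule mod0)
  have meet: "meet_of M x y \<in> univ M \<and> pl M (meet_of M x y) x = x \<and> pl M (meet_of M x y) y = y \<and>
      (\<forall>u\<in>univ M. pl M u x = x \<longrightarrow> pl M u y = y \<longrightarrow> pl M u (meet_of M x y) = meet_of M x y) \<and>
      ds M x (zr M) + ds M y (zr M) - ds M (pl M x y) (zr M) \<le> ds M (meet_of M x y) (zr M)"
    if xy: "x \<in> univ M" "y \<in> univ M" for x y
  proof -
    obtain m where m: "m \<in> univ M" "pl M m x = x" "pl M m y = y"
      "\<And>u. u \<in> univ M \<Longrightarrow> pl M u x = x \<Longrightarrow> pl M u y = y \<Longrightarrow> pl M u m = m"
      "\<And>c. (\<And>e. 0 < e \<Longrightarrow> \<exists>z\<in>univ M. defect x z < e \<and> defect y z < e \<and> c - e < ds M z (zr M))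
        \<Longrightarrow> c \<le> ds M m (zr M)"
      using ex_meet_norm_ge_approx[OF xy] by metis
    have eq: "meet_of M x y = m"
      using xy m(1-4) jn_commute by (intro meet_of_eqI) auto
    have "ds M x (zr M) + ds M y (zr M) - ds M (pl M x y) (zr M) \<le> ds M m (zr M)"
    proof (rule m(5))
      fix e :: real assume "0 < e"
      from mod[OF xy this]
      show "\<exists>z\<in>univ M. defect x z < e \<and> defect y z < e \<and>
          ds M x (zr M) + ds M y (zr M) - ds M (pl M x y) (zr M) - e < ds M z (zr M)"
        by (auto simp: algebra_simps)
    qed
    then show ?thesis using m eq by blast
  qed
  show lat: "complete_metric_lattice (univ M) (\<lambda>x y. pl M x y = y) (pl M) (meet_of M) (zr M) (on M) (ds M)"
    using meet by (intro complete_metric_latticeI) blast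
  show "metrically_modular (univ M) (pl M) (meet_of M) (zr M) (ds M)"
    unfolding metrically_modular_def
  proof (intro ballI antisym)
    fix x y assume xy: "x \<in> univ M" "y \<in> univ M"
    show "ds M (pl M x y) (zr M) + ds M (meet_of M x y) (zr M) \<le> ds M x (zr M) + ds M y (zr M)"
      by (rule complete_metric_lattice.submodular[OF lat xy])
    show "ds M x (zr M) + ds M y (zr M) \<le> ds M (pl M x y) (zr M) + ds M (meet_of M x y) (zr M)"
      using meet[OF xy] by linarith
  qed
qed

lemma modular_lattice_models_T_MML:
  fixes M :: "'a lstr"
  assumes M: "lstructure M"
    and lat: "complete_metric_lattice (univ M) (\<lambda>x y. pl M x y = y) (pl M) mt (zr M) (on M) (ds M)"
    and mod: "metrically_modular (univ M) (pl M) mt (zr M) (ds M)"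
  shows "models M T_MML"
proof -
  interpret complete_metric_lattice "univ M" "\<lambda>x y. pl M x y = y" "pl M" mt "zr M" "on M" "ds M"
    by (fact lat)
  interpret alg: T_ML_algebra "univ M" "ds M" "pl M" "zr M" "on M"
  proof
    show "ds M (zr M) (on M) = 1" using d_tp_bt by (simp add: commute)
    show "pl M x (zr M) = x" if "x \<in> univ M" for x
      using that bt jn_commute by metis
  qed (auto simp: complete bt tp jn_closed jn_idem jn_assoc d_jn intro: jn_commute
      modular_imp_d_approx_meet[OF mod])
  have "models M T_ML" using models_T_ML_iff[OF M] alg.T_ML_algebra_axioms by blast
  moreover have "eval M sigma_mod v = 0" if "valuation M v" for v
    unfolding eval_sigma_mod_eq_0_iff[OF M that]
    by (intro ballI allI impI alg.modular_imp_approx_modular[OF mod] conjI mt_closed mt_lower)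
  ultimately show ?thesis using models_T_MML_iff[OF M] by blast
qed

lemma meet_of_eq_mt:
  assumes "complete_metric_lattice (univ M) (\<lambda>x y. pl M x y = y) (pl M) mt (zr M) (on M) (ds M)"
    and xy: "x \<in> univ M" "y \<in> univ M"
  shows "meet_of M x y = mt x y"
proof -
  interpret complete_metric_lattice "univ M" "\<lambda>x y. pl M x y = y" "pl M" mt "zr M" "on M" "ds M"
    by fact
  show ?thesis
    using xy mt_closed mt_lower mt_greatest jn_commute by (intro meet_of_eqI) auto
qed

theorem proposition5p8:
  fixes M :: "'a lstr" and \<phi>\<^sub>m :: "nat \<Rightarrow> fml"
  assumes "definable_predicate TYPE('a) T_MML 3 \<phi>\<^sub>m"
    and "\<And>(N :: 'a lstr) x y z.
           \<lbrakk>models N T_MML; x \<in> univ N; y \<in> univ N; z \<in> univ N\<rbrakk> \<Longrightarrow>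
           dval N \<phi>\<^sub>m [x, y, z] = ds N (meet_of N x y) z"
    and "lstructure M"
  shows "models M (T_DML \<phi>\<^sub>m) \<longleftrightarrow>
    (\<exists>mt. complete_metric_lattice (univ M) (\<lambda>x y. pl M x y = y) (pl M) mt (zr M) (on M) (ds M) \<and>
          metrically_modular (univ M) (pl M) mt (zr M) (ds M) \<and>
          distributive_on (univ M) (pl M) mt)"
proof -
  note M = assms(3)
  let ?lat = "\<lambda>mt. complete_metric_lattice (univ M) (\<lambda>x y. pl M x y = y) (pl M) mt (zr M) (on M) (ds M)"
  let ?mod = "\<lambda>mt. metrically_modular (univ M) (pl M) mt (zr M) (ds M)"
  have pl: "\<And>x y. x \<in> univ M \<Longrightarrow> y \<in> univ M \<Longrightarrow> pl M x y \<in> univ M"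
    and z: "zr M \<in> univ M"
    using M by (auto simp: lstructure_def)
  have sigma: "eval M (sigma_dist \<phi>\<^sub>m) v = 0 \<longleftrightarrow>
      (\<forall>x\<in>univ M. \<forall>y\<in>univ M. \<forall>z\<in>univ M. \<forall>e>0. \<exists>t\<in>univ M. \<exists>w\<in>univ M.
        ds M (meet_of M x y) t < e \<and> ds M (meet_of M x z) w < e \<and>
        ds M (meet_of M x (pl M y z)) (pl M t w) < e)"
    if "models M T_MML" "valuation M v" for v
    by (rule eval_sigma_dist_eq_0_iff[OF M that(2)
          complete_metric_lattice.mt_closed[OF T_MML_model_meet(1)[OF that(1)]] assms(2)[OF that(1)]])
  show ?thesis
  proof
    assume "models M (T_DML \<phi>\<^sub>m)"
    then have MML: "models M T_MML"
      and dist: "\<And>v. valuation M v \<Longrightarrow> eval M (sigma_dist \<phi>\<^sub>m) v = 0"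
      by (simp_all add: models_T_DML_iff[OF M])
    note lat = T_MML_model_meet[OF MML]
    note mt = complete_metric_lattice.mt_closed[OF lat(1)]
    have "valuation M (\<lambda>_. zr M)" using z by (auto simp: valuation_def)
    \<comment> \<open>\<open>sigma_dist\<close> is a sentence, so its value at one valuation suffices.\<close>
    note approx = dist[OF this, unfolded sigma[OF MML this], rule_format]
    have dist: "distributive_on (univ M) (pl M) (meet_of M)"
      unfolding distributive_on_def
    proof (intro ballI)
      fix x y z assume xyz: "x \<in> univ M" "y \<in> univ M" "z \<in> univ M"
      show "meet_of M x (pl M y z) = pl M (meet_of M x y) (meet_of M x z)"
        by (rule eq_jn_if_approx[OF M mt[OF xyz(1,2)] mt[OF xyz(1,3)] mt[OF xyz(1) pl[OF xyz(2,3)]]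
              approx[OF xyz]])
    qed
    show "\<exists>mt. ?lat mt \<and> ?mod mt \<and> distributive_on (univ M) (pl M) mt"
      by (rule exI[of _ "meet_of M"], rule conjI[OF lat(1) conjI[OF lat(2) dist]])
  next
    assume "\<exists>mt. ?lat mt \<and> ?mod mt \<and> distributive_on (univ M) (pl M) mt"
    then obtain mt where lat: "?lat mt" and mod: "?mod mt"
      and dist: "distributive_on (univ M) (pl M) mt" by (elim exE conjE)
    interpret complete_metric_lattice "univ M" "\<lambda>x y. pl M x y = y" "pl M" mt "zr M" "on M" "ds M"
      by (fact lat)
    have MML: "models M T_MML" by (rule modular_lattice_models_T_MML[OF M lat mod])
    have "eval M (sigma_dist \<phi>\<^sub>m) v = 0" if "valuation M v" for v
      unfolding sigma[OF MML that]
    proof (intro ballI allI impI)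
      fix x y z and e :: real
      assume xyz: "x \<in> univ M" "y \<in> univ M" "z \<in> univ M" and e: "0 < e"
      have eq: "mt x (pl M y z) = pl M (mt x y) (mt x z)"
        using dist xyz by (simp add: distributive_on_def)
      show "\<exists>t\<in>univ M. \<exists>w\<in>univ M. ds M (meet_of M x y) t < e \<and> ds M (meet_of M x z) w < e \<and>
          ds M (meet_of M x (pl M y z)) (pl M t w) < e"
        by (rule bexI[where x = "mt x y"], rule bexI[where x = "mt x z"])
          (simp_all add: meet_of_eq_mt[OF lat] eq xyz e jn_closed mt_closed)
    qed
    then show "models M (T_DML \<phi>\<^sub>m)" using MML by (simp add: models_T_DML_iff[OF M])
  qed
qed

end
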